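(* Let $a,b$ be integers with $1<a\le b$. For all $f,g\in\mathcal A$, \begin{align*} D_q^a[f]\,P_q^b[g] &=\sum_{j=0}^{a}\sum_{i=1}^{b-a+j}(-1)^{a-j}\binom{b-1-i+j}{a-1}\binom{a}{j}D_q^j\big[f\,P_q^i[g]\big]\\ &\quad+\sum_{k=1}^{a}\sum_{i=1}^{k}(-1)^{a-k}\binom{b-1-i+k}{b-1}\binom{b}{a-k}D_q^{k-i}\big[D_q^i[f]\,g\big]\\ &\quad+\sum_{j=0}^{a-1}(-1)^{a-j}\binom{b-1+j}{j,\;a-1-j,\;b-a+j}D_q^j[fg]. \end{align*}
   Context: $\mathcal A=t\,\mathbb Q[[t,q]]$ is the (non-unital, commutative) algebra of formal power series in $t,q$ with strictly positive valuation in $t$. The $q$-dilation operator is $E_q[f](t)=f(qt)$. The $q$-summation operator is the $\mathbb Q[[q]]$-linear map $P_q:\mathcal A\to\mathcal A$, $P_q[f](t)=\sum_{n\ge0}E_q^n[f](t)=f(t)+f(qt)+f(q^2t)+\cdots$, and the $q$-difference operator is $D_q=I-E_q$, i.e. $D_q[f](t)=f(t)-f(qt)$; these are mutually inverse on $\mathcal A$. $D_q^n$ and $P_q^n$ denote $n$-fold compositions, with $D_q^0=I$. For non-negative integers $x,y,z$ with $x+y+z=N$, $\binom{N}{x,y,z}=\frac{N!}{x!\,y!\,z!}$. Empty sums (upper limit smaller than lower limit) are $0$. *)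

theory Defs
  imports "HOL-Computational_Algebra.Formal_Power_Series"
begin

text \<open>
  The ring of formal power series in \<open>t, q\<close> over the rationals is modelled as \<^typ>\<open>rat fps fps\<close>:
  the outer variable is \<open>t\<close>, and the coefficients are power series in the inner variable \<open>q\<close>.
\<close>

abbreviation q_var :: "rat fps" where
  "q_var \<equiv> fps_X"

abbreviation t_var :: "rat fps fps" where
  "t_var \<equiv> fps_X"

definition tA :: "rat fps fps set" where
  "tA = {f. fps_nth f 0 = 0}"

definition q_dilation :: "rat fps fps \<Rightarrow> rat fps fps" where
  "q_dilation f = fps_compose f (fps_const q_var * t_var)"

definition q_diff :: "rat fps fps \<Rightarrow> rat fps fps" where
  "q_diff f = f - q_dilation f"

text \<open>
  The metric on \<^typ>\<open>rat fps fps\<close> is \<open>t\<close>-adic with discrete coefficients, so \<open>f(t) + f(qt) + \<dots>\<close>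
  does not converge in it.  The sum is therefore taken separately in each coefficient of \<open>t\<close>,
  where it converges \<open>q\<close>-adically for \<open>f\<close> in \<^const>\<open>tA\<close> (lemma \<open>q_sum_sums\<close>).
\<close>

definition q_sum :: "rat fps fps \<Rightarrow> rat fps fps" where
  "q_sum f = Abs_fps (\<lambda>m. \<Sum>n. fps_nth ((q_dilation ^^ n) f) m)"

definition trinomial :: "nat \<Rightarrow> nat \<Rightarrow> nat \<Rightarrow> nat \<Rightarrow> nat" where
  "trinomial N x y z = fact N div (fact x * fact y * fact z)"
  \<comment> \<open>meaningful for \<open>x + y + z = N\<close>, in which case the division is exact\<close>

lemma q_dilation_nth: "fps_nth (q_dilation f) m = q_var ^ m * fps_nth f m"
  by (simp add: q_dilation_def)

lemma q_dilation_funpow_nth: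
  "fps_nth ((q_dilation ^^ n) f) m = (q_var ^ m) ^ n * fps_nth f m"
  by (induction n) (simp_all add: q_dilation_nth mult.assoc)

lemma geometric_fps_X_power_sums:
  fixes c :: "rat fps"
  assumes "m > 0"
  shows "(\<lambda>n. (fps_X ^ m) ^ n * c) sums (inverse (1 - fps_X ^ m) * c)"
proof -
  define u :: "rat fps" where "u = 1 - fps_X ^ m"
  have u0: "fps_nth u 0 \<noteq> 0"
    using assms by (simp add: u_def)
  have partial: "(\<Sum>i<n. (fps_X ^ m) ^ i * c) = inverse u * c - fps_X ^ (m * n) * (inverse u * c)"
    for n
  proof -
    have "(\<Sum>i<n. (fps_X ^ m) ^ i * c) = (inverse u * u) * ((\<Sum>i<n. (fps_X ^ m) ^ i) * c)"
      by (simp only: inverse_mult_eq_1[OF u0] mult_1 sum_distrib_right)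
    also have "\<dots> = inverse u * (u * (\<Sum>i<n. (fps_X ^ m) ^ i)) * c"
      by (simp only: mult.assoc)
    also have "u * (\<Sum>i<n. (fps_X ^ m) ^ i) = 1 - fps_X ^ (m * n)"
      by (simp only: u_def one_diff_power_eq power_mult)
    finally show ?thesis
      by (simp only: right_diff_distrib left_diff_distrib mult_1_right mult.assoc mult.left_commute)
  qed
  have "(\<lambda>n. \<Sum>i<n. (fps_X ^ m) ^ i * c) \<longlonglongrightarrow> inverse u * c"
    unfolding tendsto_fps_iff
  proof
    fix k
    show "\<forall>\<^sub>F n in sequentially.
            fps_nth (\<Sum>i<n. (fps_X ^ m) ^ i * c) k = fps_nth (inverse u * c) k"
      using eventually_gt_at_top[of k]
    proof eventually_elim
      case (elim n)
      have "n \<le> m * n"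
        using assms by simp
      with elim have "k < m * n"
        by linarith
      then show ?case
        by (simp only: partial fps_sub_nth fps_X_power_mult_nth if_True diff_zero)
    qed
  qed
  then show ?thesis
    by (simp add: sums_def u_def)
qed

lemma q_sum_sums:
  assumes "f \<in> tA"
  shows "(\<lambda>n. fps_nth ((q_dilation ^^ n) f) m) sums fps_nth (q_sum f) m"
proof -
  have "summable (\<lambda>n. fps_nth ((q_dilation ^^ n) f) m)"
  proof (cases "m = 0")
    case True
    then show ?thesis
      using assms by (simp add: q_dilation_funpow_nth tA_def)
  next
    case False
    then show ?thesis
      unfolding q_dilation_funpow_nth
      using geometric_fps_X_power_sums[of m] by (auto simp: summable_def)
  qed
  then show ?thesis
    by (simp add: q_sum_def summable_sums)
qed

lemma q_sum_nth:
  assumes "f \<in> tA"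
  shows "fps_nth (q_sum f) m = inverse (1 - q_var ^ m) * fps_nth f m"
proof (cases "m = 0")
  case True
  then show ?thesis
    using assms by (simp add: q_sum_def q_dilation_funpow_nth tA_def)
next
  case False
  then have "(\<lambda>n. fps_nth ((q_dilation ^^ n) f) m) sums (inverse (1 - q_var ^ m) * fps_nth f m)"
    unfolding q_dilation_funpow_nth by (intro geometric_fps_X_power_sums) simp
  with q_sum_sums[OF assms, of m] show ?thesis
    by (rule sums_unique2)
qed

lemma q_sum_in_tA: "f \<in> tA \<Longrightarrow> q_sum f \<in> tA"
  using q_sum_nth[of f 0] by (simp add: tA_def)

lemma q_diff_in_tA: "f \<in> tA \<Longrightarrow> q_diff f \<in> tA"
  by (simp add: tA_def q_diff_def q_dilation_nth)

lemma q_diff_nth: "fps_nth (q_diff f) m = (1 - q_var ^ m) * fps_nth f m"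
  by (simp add: q_diff_def q_dilation_nth algebra_simps)

lemma inverse_one_minus_q_power:
  "m \<noteq> 0 \<Longrightarrow> inverse (1 - q_var ^ m) * (1 - q_var ^ m) = 1"
  by (rule inverse_mult_eq_1) simp

lemma q_diff_q_sum:
  assumes "f \<in> tA"
  shows "q_diff (q_sum f) = f"
proof (rule fps_ext)
  fix m
  show "fps_nth (q_diff (q_sum f)) m = fps_nth f m"
  proof (cases "m = 0")
    case True
    then show ?thesis
      using assms by (simp add: q_diff_nth tA_def)
  next
    case False
    have "fps_nth (q_diff (q_sum f)) m =
        (inverse (1 - q_var ^ m) * (1 - q_var ^ m)) * fps_nth f m"
      by (simp only: q_diff_nth q_sum_nth[OF assms] mult.assoc mult.left_commute)
    then show ?thesis
      by (simp only: inverse_one_minus_q_power[OF False] mult_1)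
  qed
qed

lemma q_sum_q_diff:
  assumes "f \<in> tA"
  shows "q_sum (q_diff f) = f"
proof (rule fps_ext)
  fix m
  show "fps_nth (q_sum (q_diff f)) m = fps_nth f m"
  proof (cases "m = 0")
    case True
    then show ?thesis
      using assms q_sum_in_tA[OF q_diff_in_tA[OF assms]] by (simp add: tA_def)
  next
    case False
    have "fps_nth (q_sum (q_diff f)) m =
        (inverse (1 - q_var ^ m) * (1 - q_var ^ m)) * fps_nth f m"
      by (simp only: q_diff_nth q_sum_nth[OF q_diff_in_tA[OF assms]] mult.assoc)
    then show ?thesis
      by (simp only: inverse_one_minus_q_power[OF False] mult_1)
  qed
qed

end

theory Submission
  imports Defs
begin

unbundle fps_syntax

text \<open>
  Comparing coefficients of \<open>f\<^sub>l g\<^sub>n t\<^sup>m\<close> with \<open>l + n = m\<close>, the operators \<open>D\<^sub>q\<close> on \<open>f\<close>, \<open>P\<^sub>q\<close> on \<open>g\<close> and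
  \<open>D\<^sub>q\<close> on products become multiplication by \<open>u = 1 - q\<^sup>l\<close>, \<open>s = 1 / (1 - q\<^sup>n)\<close> and \<open>w = 1 - q\<^sup>m\<close>,
  which satisfy \<open>u s = w s + u - 1\<close>.  The right-hand side of the theorem is the normal form of
  \<open>u\<^sup>a s\<^sup>b\<close> under this rewrite rule, i.e. its expansion into monomials not divisible by \<open>u s\<close>.
  The rule gives the recurrence \<open>F(a+1, b+1) = w F(a, b+1) + F(a+1, b) - F(a, b)\<close> for
  \<open>F(a, b) = u\<^sup>a s\<^sup>b\<close>.  Since the generating function of the recurrence is
  \<open>1 / (1 - w X - Y + X Y)\<close>, the boundary values \<open>u\<^sup>a\<close> and \<open>s\<^sup>b\<close> contribute the monomials in
  \<open>w, s\<close>, those in \<open>w, u\<close> and those in \<open>w\<close> alone as three separate solutions.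
\<close>

section \<open>Coefficients of powers of linear series\<close>

text \<open>
  This is \<open>1 / (1 - c X)\<^sup>n\<close>, which need not be available as a quotient over a ring.  The binomial
  coefficient is written with lower index \<open>m\<close> so that it is also right for \<open>n = 0\<close>, where the
  subtraction truncates.
\<close>

definition geometric_power :: "'a::comm_ring_1 \<Rightarrow> nat \<Rightarrow> 'a fps" where
  "geometric_power c n = Abs_fps (\<lambda>m. of_nat ((m + n - 1) choose m) * c ^ m)"

lemma geometric_power_0 [simp]: "geometric_power c 0 = 1"
proof (rule fps_ext)
  fix m show "geometric_power c 0 $ m = 1 $ m"
    by (cases m) (simp_all add: geometric_power_def binomial_eq_0)
qed

text \<open>Pascal's rule in each coefficient; it lets a factor \<open>1 - c X\<close> be cancelled
  without division.\<close>

lemma geometric_power_Suc: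
  "(1 - fps_const c * fps_X) * geometric_power c (Suc n) = geometric_power c n"
proof (rule fps_ext)
  fix m show "((1 - fps_const c * fps_X) * geometric_power c (Suc n)) $ m = geometric_power c n $ m"
  proof (cases m)
    case 0
    then show ?thesis by (simp add: geometric_power_def)
  next
    case (Suc k)
    have "(1 - fps_const c * fps_X) * geometric_power c (Suc n)
        = geometric_power c (Suc n) - fps_const c * (fps_X * geometric_power c (Suc n))"
      by (simp add: algebra_simps)
    moreover have "Suc k + n choose Suc k = ((k + n) choose k) + ((k + n) choose Suc k)"
      by simp
    ultimately show ?thesis
      using Suc by (simp add: geometric_power_def algebra_simps)
  qed
qed

text \<open>The binomial theorem: each \<open>X ^ (n - j)\<close> shifts \<open>F\<close>, and the
  guard marks the coefficients that the shift makes zero.\<close>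

lemma const_minus_X_power_mult_nth:
  fixes c :: "'a::comm_ring_1"
  shows "((fps_const c - fps_X) ^ n * F) $ m =
    (\<Sum>j=0..n. (-1) ^ (n - j) * of_nat (n choose j) * c ^ j *
       (if n - j \<le> m then F $ (m - (n - j)) else 0))"
proof -
  have "(fps_const c - fps_X) ^ n = (\<Sum>j\<le>n. of_nat (n choose j) * fps_const c ^ j * (- fps_X) ^ (n - j))"
    using binomial_ring[of "fps_const c" "- fps_X" n] by simp
  also have "\<dots> = (\<Sum>j=0..n. fps_const ((-1) ^ (n - j) * of_nat (n choose j) * c ^ j) * fps_X ^ (n - j))"
    unfolding atLeast0AtMost
  proof (rule sum.cong[OF refl])
    fix j
    have "(- fps_X :: 'a fps) ^ (n - j) = fps_const ((-1) ^ (n - j)) * fps_X ^ (n - j)"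
      by (subst power_minus) (simp flip: fps_const_power fps_const_neg)
    then show "of_nat (n choose j) * fps_const c ^ j * (- fps_X) ^ (n - j)
        = fps_const ((-1) ^ (n - j) * of_nat (n choose j) * c ^ j) * fps_X ^ (n - j)"
      by (simp add: mult_ac fps_const_power flip: fps_of_nat fps_const_mult)
  qed
  finally show ?thesis
    by (simp add: sum_distrib_right fps_sum_nth mult.assoc fps_X_power_mult_nth not_less if_distrib
        cong: if_cong)
      (intro sum.cong refl, auto)
qed

lemma one_minus_X_power_nth:
  "((1 - fps_X) ^ n :: 'a::comm_ring_1 fps) $ m = (-1) ^ m * of_nat (n choose m)"
proof (induction n arbitrary: m)
  case 0
  then show ?case by (cases m) auto
next
  case (Suc n)
  have "((1 - fps_X) ^ Suc n :: 'a fps) = (1 - fps_X) ^ n - fps_X * (1 - fps_X) ^ n"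
    by (simp add: algebra_simps)
  then show ?case
    by (cases m) (simp_all add: Suc algebra_simps)
qed

text \<open>The recurrence computes each interior value from three earlier ones, so the values on
  the two axes determine all others.\<close>

lemma pascal_recurrence_unique:
  fixes F G :: "nat \<Rightarrow> nat \<Rightarrow> 'a::comm_ring_1"
  assumes "\<And>a b. F (Suc a) (Suc b) = w * F a (Suc b) + F (Suc a) b - F a b"
    and "\<And>a b. G (Suc a) (Suc b) = w * G a (Suc b) + G (Suc a) b - G a b"
    and "\<And>a. F a 0 = G a 0" and "\<And>b. F 0 b = G 0 b"
  shows "F a b = G a b"
proof (induction a arbitrary: b)
  case (Suc a)
  show ?case
    by (induction b) (simp_all add: assms Suc)
qed (simp add: assms)

section \<open>Three solutions of the recurrence\<close>

context
  fixes w :: "'a::comm_ring_1"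
begin

text \<open>
  \<open>P a = ((w - X) / (1 - X))\<^sup>a\<close>, \<open>Q a = (w - X)\<^sup>a / (1 - X)\<^sup>a\<^sup>+\<^sup>1\<close> and \<open>R b = ((1 - X) / (1 - w X))\<^sup>b\<close>.
\<close>

private definition P :: "nat \<Rightarrow> 'a fps" where
  "P a = (fps_const w - fps_X) ^ a * geometric_power 1 a"

private definition Q :: "nat \<Rightarrow> 'a fps" where
  "Q a = (fps_const w - fps_X) ^ a * geometric_power 1 (Suc a)"

private definition R :: "nat \<Rightarrow> 'a fps" where
  "R b = (1 - fps_X) ^ b * geometric_power w b"

private lemma P_Suc: "(1 - fps_X) * P (Suc a) = (fps_const w - fps_X) * P a"
  unfolding P_def geometric_power_Suc[of "1::'a" a, symmetric] by (simp add: mult_ac)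

private lemma Q_Suc: "(1 - fps_X) * Q (Suc a) = (fps_const w - fps_X) * Q a"
  unfolding Q_def geometric_power_Suc[of "1::'a" "Suc a", symmetric] by (simp add: mult_ac)

private lemma Q_0: "(1 - fps_X) * Q 0 = 1"
  using geometric_power_Suc[of "1::'a" 0] by (simp add: Q_def mult_ac)

private lemma R_Suc: "(1 - fps_const w * fps_X) * R (Suc b) = (1 - fps_X) * R b"
  unfolding R_def geometric_power_Suc[of w b, symmetric] by (simp add: mult_ac)

private lemma P_0_nth: "P 0 $ n = (if n = 0 then 1 else 0)"
  by (simp add: P_def)

private lemma R_0_nth: "R 0 $ n = (if n = 0 then 1 else 0)"
  by (simp add: R_def)

text \<open>Comparing coefficients turns the functional equation into the recurrence:
  \<open>n\<close> plays the role of \<open>b\<close>, and passing from \<open>F\<close> to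
  \<open>G\<close> raises \<open>a\<close>.\<close>

private lemma ratio_nth:
  assumes "(1 - fps_X) * G = (fps_const w - fps_X) * (F :: 'a fps)"
  shows "G $ 0 = w * F $ 0" and "G $ Suc n = w * F $ Suc n + G $ n - F $ n"
proof -
  have *: "G $ m - (fps_X * G) $ m = w * F $ m - (fps_X * F) $ m" for m
    using arg_cong[OF assms, of "\<lambda>H. H $ m"] by (simp add: left_diff_distrib)
  from *[of 0] show "G $ 0 = w * F $ 0" by simp
  from *[of "Suc n"] show "G $ Suc n = w * F $ Suc n + G $ n - F $ n"
    by (simp add: algebra_simps)
qed

private lemma R_nth: "R b $ 0 = 1" "R (Suc b) $ Suc n = w * R (Suc b) $ n + R b $ Suc n - R b $ n"
proof -
  show "R b $ 0 = 1" by (simp add: R_def geometric_power_def fps_nth_power_0)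
  have "(R (Suc b) - fps_const w * (fps_X * R (Suc b))) $ Suc n = (R b - fps_X * R b) $ Suc n"
    using arg_cong[OF R_Suc[of b], of "\<lambda>H. H $ Suc n"] by (simp add: algebra_simps)
  then show "R (Suc b) $ Suc n = w * R (Suc b) $ n + R b $ Suc n - R b $ n"
    by (simp add: algebra_simps)
qed

text \<open>The solution with values \<open>s ^ b\<close> on the axis \<open>a = 0\<close> away from
  the origin, and 0 on \<open>b = 0\<close>. \<open>U_part\<close> is its counterpart for
  \<open>u ^ a\<close> on the axis \<open>b = 0\<close>.\<close>

private definition S_part :: "'a \<Rightarrow> nat \<Rightarrow> nat \<Rightarrow> 'a" where
  "S_part s a b = (\<Sum>i=1..b. s ^ i * P a $ (b - i))"

private definition U_part :: "'a \<Rightarrow> nat \<Rightarrow> nat \<Rightarrow> 'a" where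
  "U_part u a b = (\<Sum>i=1..a. u ^ i * R b $ (a - i))"

text \<open>The value \<open>1\<close> at the origin makes the recurrence hold at \<open>(1, 1)\<close> too.\<close>

private definition T_part :: "nat \<Rightarrow> nat \<Rightarrow> 'a" where
  "T_part a b = (if a = 0 \<and> b = 0 then 1 else if a = 0 \<or> b = 0 then 0 else - (Q (a - 1) $ (b - 1)))"

private lemma S_part_Suc:
  "S_part s (Suc a) (Suc b) = w * S_part s a (Suc b) + S_part s (Suc a) b - S_part s a b"
proof -
  have 1: "P (Suc a) $ (Suc b - i) = w * P a $ (Suc b - i) + P (Suc a) $ (b - i) - P a $ (b - i)"
    if "i \<in> {1..b}" for i
    using that ratio_nth(2)[OF P_Suc[of a], of "b - i"] by (simp add: Suc_diff_le)
  have "S_part s (Suc a) (Suc b) = (\<Sum>i=1..b. s ^ i * P (Suc a) $ (Suc b - i)) + s ^ Suc b * P (Suc a) $ 0"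
    by (simp add: S_part_def)
  also have "(\<Sum>i=1..b. s ^ i * P (Suc a) $ (Suc b - i))
     = (\<Sum>i=1..b. s ^ i * (w * P a $ (Suc b - i) + P (Suc a) $ (b - i) - P a $ (b - i)))"
    by (rule sum.cong[OF refl]) (simp only: 1)
  also have "\<dots> = w * (\<Sum>i=1..b. s ^ i * P a $ (Suc b - i)) + S_part s (Suc a) b - S_part s a b"
    by (simp add: S_part_def sum_distrib_left algebra_simps sum.distrib sum_subtractf)
  \<comment> \<open>The new index \<open>i = b + 1\<close> sees only constant coefficients, where
    the recurrence reduces to its \<open>w\<close> term.\<close>
  also have "P (Suc a) $ 0 = w * P a $ 0" by (rule ratio_nth(1)[OF P_Suc])
  finally show ?thesis by (simp add: S_part_def algebra_simps)
qed

private lemma U_part_Suc: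
  "U_part u (Suc a) (Suc b) = w * U_part u a (Suc b) + U_part u (Suc a) b - U_part u a b"
proof -
  have 1: "R (Suc b) $ (Suc a - i) = w * R (Suc b) $ (a - i) + R b $ (Suc a - i) - R b $ (a - i)"
    if "i \<in> {1..a}" for i
    using that R_nth(2)[of b "a - i"] by (simp add: Suc_diff_le)
  \<comment> \<open>The top term \<open>u ^ Suc a\<close> also ends
    \<open>U_part u (Suc a) b\<close>, as every \<open>R b\<close> has constant coefficient
    1.\<close>
  have "U_part u (Suc a) (Suc b) = (\<Sum>i=1..a. u ^ i * R (Suc b) $ (Suc a - i)) + u ^ Suc a"
    by (simp add: U_part_def R_nth)
  also have "(\<Sum>i=1..a. u ^ i * R (Suc b) $ (Suc a - i))
     = (\<Sum>i=1..a. u ^ i * (w * R (Suc b) $ (a - i) + R b $ (Suc a - i) - R b $ (a - i)))"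
    by (rule sum.cong[OF refl]) (simp only: 1)
  also have "\<dots> = w * U_part u a (Suc b) + (\<Sum>i=1..a. u ^ i * R b $ (Suc a - i)) - U_part u a b"
    by (simp add: U_part_def sum_distrib_left algebra_simps sum.distrib sum_subtractf)
  finally show ?thesis by (simp add: U_part_def R_nth algebra_simps)
qed

private lemma T_part_Suc:
  "T_part (Suc a) (Suc b) = w * T_part a (Suc b) + T_part (Suc a) b - T_part a b"
proof (cases a)
  case 0
  \<comment> \<open>All coefficients of \<open>Q 0\<close> agree; the 1 at index 0 matches the value
    of \<open>T_part\<close> at the origin.\<close>
  have "Q 0 $ m - (fps_X * Q 0) $ m = (1 :: 'a fps) $ m" for m
    using arg_cong[OF Q_0, of "\<lambda>H. H $ m"] by (simp add: left_diff_distrib)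
  from this[of b] 0 show ?thesis
    by (cases b) (simp_all add: T_part_def)
next
  case (Suc c)
  then show ?thesis
    using ratio_nth[OF Q_Suc[of c]] by (cases b) (simp_all add: T_part_def)
qed

private lemma power_mult_power_parts:
  assumes "u * s = w * s + u - 1"
  shows "u ^ a * s ^ b = S_part s a b + U_part u a b + T_part a b"
proof (rule pascal_recurrence_unique[where w = w and F = "\<lambda>a b. u ^ a * s ^ b"])
  fix a b
  have "u ^ Suc a * s ^ Suc b = u ^ a * s ^ b * (u * s)"
    by (simp add: mult_ac)
  also have "\<dots> = w * (u ^ a * s ^ Suc b) + u ^ Suc a * s ^ b - u ^ a * s ^ b"
    unfolding assms by (simp add: algebra_simps)
  finally show "u ^ Suc a * s ^ Suc b = w * (u ^ a * s ^ Suc b) + u ^ Suc a * s ^ b - u ^ a * s ^ b" .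
next
  fix a b
  show "S_part s (Suc a) (Suc b) + U_part u (Suc a) (Suc b) + T_part (Suc a) (Suc b) =
    w * (S_part s a (Suc b) + U_part u a (Suc b) + T_part a (Suc b)) +
    (S_part s (Suc a) b + U_part u (Suc a) b + T_part (Suc a) b) -
    (S_part s a b + U_part u a b + T_part a b)"
    unfolding S_part_Suc U_part_Suc T_part_Suc by (simp add: algebra_simps)
next
  fix a
  \<comment> \<open>\<open>R 0 = 1\<close> leaves only \<open>i = a\<close>; for
    \<open>a = 0\<close> the sum is empty and \<open>T_part\<close> supplies the 1.\<close>
  have "U_part u a 0 = (if a = 0 then 0 else u ^ a)"
  proof (cases a)
    case (Suc c)
    have "U_part u (Suc c) 0 = (\<Sum>i=1..c. u ^ i * R 0 $ (Suc c - i)) + u ^ Suc c * R 0 $ 0"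
      by (simp add: U_part_def)
    also have "(\<Sum>i=1..c. u ^ i * R 0 $ (Suc c - i)) = 0"
      by (rule sum.neutral) (auto simp: R_0_nth)
    finally show ?thesis using Suc by (simp add: R_0_nth)
  qed (simp add: U_part_def)
  then show "u ^ a * s ^ 0 = S_part s a 0 + U_part u a 0 + T_part a 0"
    by (simp add: S_part_def T_part_def)
next
  fix b
  have "S_part s 0 b = (if b = 0 then 0 else s ^ b)"
  proof (cases b)
    case (Suc c)
    have "S_part s 0 (Suc c) = (\<Sum>i=1..c. s ^ i * P 0 $ (Suc c - i)) + s ^ Suc c * P 0 $ 0"
      by (simp add: S_part_def)
    also have "(\<Sum>i=1..c. s ^ i * P 0 $ (Suc c - i)) = 0"
      by (rule sum.neutral) (auto simp: P_0_nth)
    finally show ?thesis using Suc by (simp add: P_0_nth)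
  qed (simp add: S_part_def)
  then show "u ^ 0 * s ^ b = S_part s 0 b + U_part u 0 b + T_part 0 b"
    by (simp add: U_part_def T_part_def)
qed

section \<open>Closed forms of the three solutions\<close>

private lemma S_part_eq:
  assumes "1 \<le> a" and "a \<le> b"
  shows "S_part s a b = (\<Sum>j=0..a. \<Sum>i=1..b-a+j.
    (-1) ^ (a - j) * of_nat ((b - 1 + j - i) choose (a - 1)) * of_nat (a choose j) * (w ^ j * s ^ i))"
proof -
  have "S_part s a b = (\<Sum>i=1..b. \<Sum>j=0..a. if a - j \<le> b - i then
    (-1) ^ (a - j) * of_nat ((b - 1 + j - i) choose (a - 1)) * of_nat (a choose j) * (w ^ j * s ^ i) else 0)"
    unfolding S_part_def P_def const_minus_X_power_mult_nth sum_distrib_left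
  proof (intro sum.cong refl)
    fix i j
    assume ij: "i \<in> {1..b}" "j \<in> {0..a}"
    have "(b - i - (a - j) + a - 1) choose (b - i - (a - j)) = (b - 1 + j - i) choose (a - 1)"
      if "a - j \<le> b - i"
    proof -
      have "b - i - (a - j) + a - 1 = b - 1 + j - i" "b - 1 + j - i - (b - i - (a - j)) = a - 1"
        "b - i - (a - j) \<le> b - 1 + j - i"
        using that ij assms by auto
      then show ?thesis by (metis binomial_symmetric)
    qed
    then show "s ^ i * ((-1) ^ (a - j) * of_nat (a choose j) * w ^ j *
        (if a - j \<le> b - i then geometric_power 1 a $ (b - i - (a - j)) else 0)) =
      (if a - j \<le> b - i then (-1) ^ (a - j) * of_nat ((b - 1 + j - i) choose (a - 1)) *
        of_nat (a choose j) * (w ^ j * s ^ i) else 0)"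
      by (simp add: geometric_power_def mult_ac)
  qed
  also have "\<dots> = (\<Sum>j=0..a. \<Sum>i=1..b. if a - j \<le> b - i then
    (-1) ^ (a - j) * of_nat ((b - 1 + j - i) choose (a - 1)) * of_nat (a choose j) * (w ^ j * s ^ i) else 0)"
    by (rule sum.swap)
  \<comment> \<open>Since \<open>j \<le> a \<le> b\<close>, the guard amounts to
    \<open>i \<le> b - a + j\<close>.\<close>
  also have "\<dots> = (\<Sum>j=0..a. \<Sum>i=1..b-a+j.
    (-1) ^ (a - j) * of_nat ((b - 1 + j - i) choose (a - 1)) * of_nat (a choose j) * (w ^ j * s ^ i))"
    using assms by (intro sum.cong[OF refl] sum.mono_neutral_cong_right) auto
  finally show ?thesis .
qed

private lemma U_part_eq:
  assumes "1 \<le> b"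
  shows "U_part u a b = (\<Sum>k=1..a. \<Sum>i=1..k.
    (-1) ^ (a - k) * of_nat ((b - 1 + k - i) choose (b - 1)) * of_nat (b choose (a - k)) * (w ^ (k - i) * u ^ i))"
proof -
  let ?t = "\<lambda>i k. (-1) ^ (a - k) * of_nat ((b - 1 + k - i) choose (b - 1)) * of_nat (b choose (a - k)) * (w ^ (k - i) * u ^ i)"
  have "u ^ i * R b $ (a - i) = (\<Sum>k=i..a. ?t i k)" if i: "i \<in> {1..a}" for i
  proof -
    have "u ^ i * R b $ (a - i) = (\<Sum>l=0..a-i. u ^ i * ((-1) ^ l * of_nat (b choose l) *
        geometric_power w b $ (a - i - l)))"
      by (simp add: R_def fps_mult_nth one_minus_X_power_nth sum_distrib_left)
    also have "\<dots> = (\<Sum>k=i..a. ?t i k)"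
    \<comment> \<open>Here \<open>k = a - l\<close>, where \<open>l\<close> is the exponent taken
      from \<open>(1 - X) ^ b\<close>.\<close>
    proof (rule sum.reindex_bij_witness[where i = "\<lambda>k. a - k" and j = "\<lambda>l. a - l"])
      fix l assume l: "l \<in> {0..a-i}"
      have "(a - i - l + b - 1) choose (a - i - l) = (b - 1 + (a - l) - i) choose (b - 1)"
      proof -
        have "a - i - l + b - 1 = b - 1 + (a - l) - i" "b - 1 + (a - l) - i - (a - i - l) = b - 1"
          "a - i - l \<le> b - 1 + (a - l) - i"
          using l i assms by auto
        then show ?thesis by (metis binomial_symmetric)
      qed
      moreover have "a - (a - l) = l" "a - l - i = a - i - l" using l by auto
      ultimately show "?t i (a - l) = u ^ i * ((-1) ^ l * of_nat (b choose l) *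
          geometric_power w b $ (a - i - l))"
        by (simp only: geometric_power_def fps_nth_Abs_fps mult_ac)
    qed (use i in auto)
    finally show ?thesis .
  qed
  then have "U_part u a b = (\<Sum>i=1..a. \<Sum>k=i..a. ?t i k)"
    by (simp add: U_part_def)
  \<comment> \<open>Padding the triangle to a square makes the two ranges independent.\<close>
  also have "\<dots> = (\<Sum>i=1..a. \<Sum>k=1..a. if i \<le> k then ?t i k else 0)"
    by (intro sum.cong[OF refl] sum.mono_neutral_cong_left) auto
  also have "\<dots> = (\<Sum>k=1..a. \<Sum>i=1..a. if i \<le> k then ?t i k else 0)"
    by (rule sum.swap)
  also have "\<dots> = (\<Sum>k=1..a. \<Sum>i=1..k. ?t i k)"
    by (intro sum.cong[OF refl] sum.mono_neutral_cong_right) auto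
  finally show ?thesis .
qed

private lemma T_part_eq:
  assumes "1 \<le> a" and "a \<le> b"
  shows "T_part a b = (\<Sum>j=0..a-1.
    (-1) ^ (a - j) * of_nat (trinomial (b - 1 + j) j (a - 1 - j) (b - a + j)) * w ^ j)"
proof -
  have "T_part a b = - (Q (a - 1) $ (b - 1))"
    using assms by (simp add: T_part_def)
  also have "\<dots> = (\<Sum>j=0..a-1.
    (-1) ^ (a - j) * of_nat (trinomial (b - 1 + j) j (a - 1 - j) (b - a + j)) * w ^ j)"
    unfolding Q_def const_minus_X_power_mult_nth sum_negf[symmetric]
  proof (rule sum.cong[OF refl])
    fix j assume "j \<in> {0..a-1}"
    then have j: "j \<le> a - 1" by simp
    \<comment> \<open>The two binomials multiply to the trinomial because
      \<open>fact (a - 1)\<close> cancels.\<close>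
    have "fact j * fact (a - 1 - j) * (a - 1 choose j) = (fact (a - 1) :: nat)"
      using j by (rule binomial_fact_lemma)
    moreover have "fact (b - a + j) * fact (a - 1) * (b - 1 + j choose (b - a + j)) = (fact (b - 1 + j) :: nat)"
      using binomial_fact_lemma[of "b - a + j" "b - 1 + j"] assms by simp
    ultimately have "(fact (b - 1 + j) :: nat) = (a - 1 choose j) * (b - 1 + j choose (b - a + j)) *
        (fact j * fact (a - 1 - j) * fact (b - a + j))"
      by (metis mult.assoc mult.commute)
    then have tri: "trinomial (b - 1 + j) j (a - 1 - j) (b - a + j) = (a - 1 choose j) * (b - 1 + j choose (b - a + j))"
      by (simp add: trinomial_def)
    \<comment> \<open>The last equation absorbs the minus sign of \<open>T_part\<close> into the
      power of -1.\<close>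
    have "b - 1 - (a - 1 - j) = b - a + j" "b - a + j + Suc (a - 1) - 1 = b - 1 + j"
      "a - 1 - j \<le> b - 1" "a - j = Suc (a - 1 - j)"
      using j assms by auto
    then show "- ((-1) ^ (a - 1 - j) * of_nat (a - 1 choose j) * w ^ j *
        (if a - 1 - j \<le> b - 1 then geometric_power 1 (Suc (a - 1)) $ (b - 1 - (a - 1 - j)) else 0)) =
      (-1) ^ (a - j) * of_nat (trinomial (b - 1 + j) j (a - 1 - j) (b - a + j)) * w ^ j"
      unfolding tri by (simp add: geometric_power_def mult_ac)
  qed
  finally show ?thesis .
qed

text \<open>Adding \<open>j\<close> or \<open>k\<close> before subtracting \<open>i\<close> avoids
  truncation: \<open>i\<close> reaches \<open>b\<close> when \<open>j = a\<close>.\<close>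

lemma power_mult_power_normal_form:
  assumes "u * s = w * s + u - 1" and "1 \<le> a" and "a \<le> b"
  shows "u ^ a * s ^ b =
      (\<Sum>j=0..a. \<Sum>i=1..b-a+j.
         (-1) ^ (a - j) * of_nat ((b - 1 + j - i) choose (a - 1)) * of_nat (a choose j) * (w ^ j * s ^ i))
    + (\<Sum>k=1..a. \<Sum>i=1..k.
         (-1) ^ (a - k) * of_nat ((b - 1 + k - i) choose (b - 1)) * of_nat (b choose (a - k))
           * (w ^ (k - i) * u ^ i))
    + (\<Sum>j=0..a-1.
         (-1) ^ (a - j) * of_nat (trinomial (b - 1 + j) j (a - 1 - j) (b - a + j)) * w ^ j)"
  using assms S_part_eq[of a b s] U_part_eq[of b u a] T_part_eq[of a b]
  by (simp only: power_mult_power_parts[OF assms(1)])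

end

section \<open>Transfer to the \<open>q\<close>-operators\<close>

lemma q_diff_funpow_nth: "(q_diff ^^ n) f $ m = (1 - q_var ^ m) ^ n * f $ m"
  by (induction n) (simp_all add: q_diff_nth mult.assoc)

lemma q_sum_funpow_in_tA: "f \<in> tA \<Longrightarrow> (q_sum ^^ n) f \<in> tA"
  by (induction n) (simp_all add: q_sum_in_tA)

lemma q_sum_funpow_nth:
  "f \<in> tA \<Longrightarrow> (q_sum ^^ n) f $ m = inverse (1 - q_var ^ m) ^ n * f $ m"
  by (induction n) (simp_all add: q_sum_nth q_sum_funpow_in_tA mult.assoc)

lemma sign_of_nat_mult_nth:
  "((-1) ^ n * of_nat c * F) $ m = (-1) ^ n * of_nat c * (F :: 'a::comm_ring_1 fps) $ m"
proof -
  have "(-1) ^ n * of_nat c = fps_const ((-1) ^ n * of_nat c :: 'a)"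
    by (simp add: fps_of_nat flip: fps_const_mult fps_const_power fps_const_neg)
  then show ?thesis by simp
qed

theorem proposition4:
  fixes a b :: nat and f g :: "rat fps fps"
  assumes "1 < a" and "a \<le> b"
    and "f \<in> tA" and "g \<in> tA"
  shows "(q_diff ^^ a) f * (q_sum ^^ b) g =
      (\<Sum>j=0..a. \<Sum>i=1..b-a+j.
         (-1) ^ (a - j) * of_nat ((b - 1 + j - i) choose (a - 1)) * of_nat (a choose j)
           * (q_diff ^^ j) (f * (q_sum ^^ i) g))
    + (\<Sum>k=1..a. \<Sum>i=1..k.
         (-1) ^ (a - k) * of_nat ((b - 1 + k - i) choose (b - 1)) * of_nat (b choose (a - k))
           * (q_diff ^^ (k - i)) ((q_diff ^^ i) f * g))
    + (\<Sum>j=0..a-1.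
         (-1) ^ (a - j) * of_nat (trinomial (b - 1 + j) j (a - 1 - j) (b - a + j))
           * (q_diff ^^ j) (f * g))"
    (is "?L = ?R")
proof (rule fps_ext)
  fix m
  let ?u = "\<lambda>l. 1 - q_var ^ l :: rat fps" and ?s = "\<lambda>l. inverse (1 - q_var ^ (m - l)) :: rat fps"
    and ?w = "1 - q_var ^ m :: rat fps"
  have sign2: "((-1) ^ n * of_nat c * of_nat d * F) $ m = (-1) ^ n * of_nat c * of_nat d * F $ m"
    for n c d and F :: "rat fps fps"
    using sign_of_nat_mult_nth[of n "c * d" F m] by (simp add: mult.assoc)
  have "?L $ m = (\<Sum>l=0..m. ?u l ^ a * ?s l ^ b * (f $ l * g $ (m - l)))"
    unfolding fps_mult_nth q_diff_funpow_nth q_sum_funpow_nth[OF assms(4)] sum_distrib_left by (simp add: mult_ac)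
  also have "\<dots> = (\<Sum>l=0..m.
      ((\<Sum>j=0..a. \<Sum>i=1..b-a+j.
         (-1) ^ (a - j) * of_nat ((b - 1 + j - i) choose (a - 1)) * of_nat (a choose j) * (?w ^ j * ?s l ^ i))
    + (\<Sum>k=1..a. \<Sum>i=1..k.
         (-1) ^ (a - k) * of_nat ((b - 1 + k - i) choose (b - 1)) * of_nat (b choose (a - k))
           * (?w ^ (k - i) * ?u l ^ i))
    + (\<Sum>j=0..a-1.
         (-1) ^ (a - j) * of_nat (trinomial (b - 1 + j) j (a - 1 - j) (b - a + j)) * ?w ^ j))
    * (f $ l * g $ (m - l)))"
  proof (rule sum.cong[OF refl])
    fix l assume l: "l \<in> {0..m}"
    show "?u l ^ a * ?s l ^ b * (f $ l * g $ (m - l)) =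
      ((\<Sum>j=0..a. \<Sum>i=1..b-a+j.
         (-1) ^ (a - j) * of_nat ((b - 1 + j - i) choose (a - 1)) * of_nat (a choose j) * (?w ^ j * ?s l ^ i))
    + (\<Sum>k=1..a. \<Sum>i=1..k.
         (-1) ^ (a - k) * of_nat ((b - 1 + k - i) choose (b - 1)) * of_nat (b choose (a - k))
           * (?w ^ (k - i) * ?u l ^ i))
    + (\<Sum>j=0..a-1.
         (-1) ^ (a - j) * of_nat (trinomial (b - 1 + j) j (a - 1 - j) (b - a + j)) * ?w ^ j))
    * (f $ l * g $ (m - l))"
    proof (cases "l = m")
      case True
      then show ?thesis using assms(4) by (simp add: tA_def)
    next
      case False
      then have inv: "?s l * (1 - q_var ^ (m - l)) = 1"
        using l by (intro inverse_one_minus_q_power) auto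
      have "q_var ^ m = q_var ^ l * q_var ^ (m - l)"
        using l by (simp flip: power_add)
      \<comment> \<open>Multiplying by \<open>?s l\<close> cancels
        \<open>1 - q_var ^ (m - l)\<close> and leaves \<open>q_var ^ l = 1 - ?u l\<close>, which is
        the rewrite rule.\<close>
      then have "?w - ?u l = q_var ^ l * (1 - q_var ^ (m - l))"
        by (simp add: algebra_simps)
      then have "(?w - ?u l) * ?s l = q_var ^ l * (?s l * (1 - q_var ^ (m - l)))"
        by (simp only: mult_ac)
      then have "(?w - ?u l) * ?s l = 1 - ?u l"
        by (simp add: inv)
      then have "?u l * ?s l = ?w * ?s l + ?u l - 1"
        by (simp add: algebra_simps)
      from power_mult_power_normal_form[OF this, of a b] show ?thesis
        using assms by simp
    qed
  qed
  also have "\<dots> = ?R $ m"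
  proof -
    have 1: "(q_diff ^^ j) (f * (q_sum ^^ i) g) $ m =
        (\<Sum>l=0..m. (?w ^ j * ?s l ^ i) * (f $ l * g $ (m - l)))" for i j
      unfolding fps_mult_nth q_diff_funpow_nth q_sum_funpow_nth[OF assms(4)] sum_distrib_left by (simp add: mult_ac)
    have 2: "(q_diff ^^ j) ((q_diff ^^ i) f * g) $ m =
        (\<Sum>l=0..m. (?w ^ j * ?u l ^ i) * (f $ l * g $ (m - l)))" for i j
      unfolding fps_mult_nth q_diff_funpow_nth sum_distrib_left by (simp add: mult_ac)
    have 3: "(q_diff ^^ j) (f * g) $ m = (\<Sum>l=0..m. ?w ^ j * (f $ l * g $ (m - l)))" for j
      unfolding fps_mult_nth q_diff_funpow_nth sum_distrib_left by (simp add: mult_ac)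
    show ?thesis
      unfolding fps_add_nth fps_sum_nth sign2 sign_of_nat_mult_nth 1 2 3
        distrib_right sum.distrib sum_distrib_right sum_distrib_left
      \<comment> \<open>The two sides now differ only in the position of the sum over
        \<open>l\<close>.\<close>
      by (simp only: mult.assoc sum.swap[of _ _ "{0..m}"])
  qed
  finally show "?L $ m = ?R $ m" .
qed

end
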